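(* Let $m,n\ge1$ be integers, $A\in\mathbb{R}^{m\times n}$, $b\in\mathbb{R}^m$, $\gamma>0$ and $p\in[1,\infty)$. Let $B=A\nabla\in\mathbb{R}^{m\times(n+1)}$, and let $x^*\in\mathbb{R}^{n+1}$ be a minimizer of the inverse Potts functional associated with the matrix $B$, i.e., $$x^*\in\arg\min_{x\in\mathbb{R}^{n+1}}\ \gamma\,\|\nabla x\|_0+\|Bx-b\|_p^p.$$ Then $u^*=\nabla x^*\in\mathbb{R}^n$ is a minimizer of the sparsity problem related to the matrix $A$ and data $b$, i.e., $$u^*\in\arg\min_{u\in\mathbb{R}^n}\ \gamma\,\|u\|_0+\|Au-b\|_p^p.$$
   Context: $\nabla:\mathbb{R}^{n+1}\to\mathbb{R}^n$ is the discrete difference operator, $(\nabla x)_i=x_{i+1}-x_i$ for $i=1,\dots,n$ (identified with its matrix). $\|u\|_0=|\{i:u_i\neq0\}|$ is the number of non-zero entries of $u$, so $\|\nabla x\|_0=|\{i: x_i\ne x_{i+1}\}|$ is the number of jumps of $x$. $\|y\|_p^p=\sum_i|y_i|^p$. *)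

theory Defs
  imports Complex_Main "Jordan_Normal_Form.Matrix"
begin

text \<open>Vectors and matrices are those of Jordan Normal Form, whose dimensions are natural numbers,
  so that both $n$ and $n+1$ can occur. Indices start at 0.\<close>

definition nabla :: "real vec \<Rightarrow> real vec" where
  "nabla x = vec (dim_vec x - 1) (\<lambda>i. x $ (i + 1) - x $ i)"

definition nabla_mat :: "nat \<Rightarrow> real mat" where
  "nabla_mat n = mat n (n + 1) (\<lambda>(i, j). if j = i + 1 then 1 else if j = i then -1 else 0)"

lemma nabla_mat_mult_vec:
  assumes "x \<in> carrier_vec (n + 1)"
  shows "nabla_mat n *\<^sub>v x = nabla x"
proof (rule eq_vecI)
  show "dim_vec (nabla_mat n *\<^sub>v x) = dim_vec (nabla x)"
    using assms by (simp add: nabla_mat_def nabla_def)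
next
  fix i assume "i < dim_vec (nabla x)"
  with assms have i: "i < n" by (simp add: nabla_def)
  have "(nabla_mat n *\<^sub>v x) $ i
      = (\<Sum>j\<in>{0..<n + 1}. (if j = i + 1 then 1 else if j = i then -1 else 0) * x $ j)"
    using i assms by (auto simp: nabla_mat_def scalar_prod_def intro!: sum.cong)
  also have "\<dots> = (\<Sum>j\<in>{0..<n + 1}. (if j = i + 1 then x $ j else 0) - (if j = i then x $ j else 0))"
    by (rule sum.cong) auto
  also have "\<dots> = x $ (i + 1) - x $ i"
    using i by (simp add: sum_subtractf del: sum.op_ivl_Suc)
  finally show "(nabla_mat n *\<^sub>v x) $ i = nabla x $ i"
    using i assms by (simp add: nabla_def)
qed

definition l0_norm :: "real vec \<Rightarrow> nat" where
  "l0_norm u = card {i. i < dim_vec u \<and> u $ i \<noteq> 0}"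

text \<open>The $p$-th power of the $p$-norm.\<close>

definition lp_pow :: "real \<Rightarrow> real vec \<Rightarrow> real" where
  "lp_pow p y = (\<Sum>i<dim_vec y. \<bar>y $ i\<bar> powr p)"

definition inverse_potts :: "real \<Rightarrow> real \<Rightarrow> real mat \<Rightarrow> real vec \<Rightarrow> real vec \<Rightarrow> real" where
  "inverse_potts \<gamma> p B b x = \<gamma> * real (l0_norm (nabla x)) + lp_pow p (B *\<^sub>v x - b)"

definition sparsity :: "real \<Rightarrow> real \<Rightarrow> real mat \<Rightarrow> real vec \<Rightarrow> real vec \<Rightarrow> real" where
  "sparsity \<gamma> p A b u = \<gamma> * real (l0_norm u) + lp_pow p (A *\<^sub>v u - b)"

end

theory Submission imports Defs begin

text \<open>The difference operator maps $\mathbb{R}^{n+1}$ onto $\mathbb{R}^n$: partial sums provide a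
  right inverse. Since $(A\nabla)x = A(\nabla x)$, the inverse Potts functional of $A\nabla$ is the
  sparsity functional of $A$ pulled back along $\nabla$. A minimizer of a pullback along a
  surjection maps to a minimizer of the original functional.\<close>

lemma nabla_carrier_vec:
  assumes "x \<in> carrier_vec (n + 1)"
  shows "nabla x \<in> carrier_vec n"
  using assms by (auto simp: nabla_def)

lemma nabla_surj:
  assumes "u \<in> carrier_vec n"
  shows "\<exists>y \<in> carrier_vec (n + 1). nabla y = u"
proof
  let ?y = "vec (n + 1) (\<lambda>i. \<Sum>j<i. u $ j)"
  show "?y \<in> carrier_vec (n + 1)" by simp
  show "nabla ?y = u"
    using assms by (intro eq_vecI) (auto simp: nabla_def)
qed

lemma inverse_potts_eq_sparsity_nabla:
  assumes "A \<in> carrier_mat m n" and "y \<in> carrier_vec (n + 1)"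
  shows "inverse_potts \<gamma> p (A * nabla_mat n) b y = sparsity \<gamma> p A b (nabla y)"
proof -
  have "nabla_mat n \<in> carrier_mat n (n + 1)"
    by (simp add: nabla_mat_def)
  then have "(A * nabla_mat n) *\<^sub>v y = A *\<^sub>v (nabla_mat n *\<^sub>v y)"
    using assms by (intro assoc_mult_mat_vec)
  then show ?thesis
    using assms by (simp add: inverse_potts_def sparsity_def nabla_mat_mult_vec)
qed

lemma is_arg_min_image:
  assumes min: "is_arg_min f P x"
    and maps: "\<And>y. P y \<Longrightarrow> Q (h y)"
    and onto: "\<And>u. Q u \<Longrightarrow> \<exists>y. P y \<and> h y = u"
    and pullback: "\<And>y. P y \<Longrightarrow> f y = g (h y)"
  shows "is_arg_min g Q (h x)"
  using assms unfolding is_arg_min_def by metis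

theorem theorem4:
  fixes m n :: nat and A :: "real mat" and b x :: "real vec" and \<gamma> p :: real
  assumes "m \<ge> 1" and "n \<ge> 1"
    and "A \<in> carrier_mat m n" and "b \<in> carrier_vec m"
    and "\<gamma> > 0" and "p \<ge> 1"
    and "is_arg_min (inverse_potts \<gamma> p (A * nabla_mat n) b) (\<lambda>y. y \<in> carrier_vec (n + 1)) x"
  shows "is_arg_min (sparsity \<gamma> p A b) (\<lambda>u. u \<in> carrier_vec n) (nabla x)"
  using assms(7)
proof (rule is_arg_min_image)
  show "nabla y \<in> carrier_vec n" if "y \<in> carrier_vec (n + 1)" for y
    using that by (rule nabla_carrier_vec)
  show "\<exists>y. y \<in> carrier_vec (n + 1) \<and> nabla y = u" if "u \<in> carrier_vec n" for u
    using nabla_surj[OF that] by blast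
  show "inverse_potts \<gamma> p (A * nabla_mat n) b y = sparsity \<gamma> p A b (nabla y)"
    if "y \<in> carrier_vec (n + 1)" for y
    using assms(3) that by (rule inverse_potts_eq_sparsity_nabla)
qed

end
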